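(* Let $N:\mathfrak{g}\to\mathfrak{g}$ be a Nijenhuis operator on a compatible Hom-Lie algebra $(\mathfrak{g},[~,~]_1,[~,~]_2,\alpha)$. Then $(\omega_1,\omega_2)$ generates a trivial linear deformation of the compatible Hom-Lie algebra $(\mathfrak{g},[~,~]_1,[~,~]_2,\alpha)$, where $$\omega_i(x,y)=[Nx,y]_i+[x,Ny]_i-N[x,y]_i,\qquad i=1,2,\ x,y\in\mathfrak{g}.$$
   Context: All vector spaces are over a field $\mathbb{K}$ of characteristic zero. A Hom-Lie algebra $(\mathfrak{g},[~,~],\alpha)$ is a vector space $\mathfrak{g}$ with a bilinear skew-symmetric bracket and a linear map $\alpha:\mathfrak{g}\to\mathfrak{g}$ such that $\alpha[x,y]=[\alpha(x),\alpha(y)]$ and $[[x,y],\alpha(z)]+[[y,z],\alpha(x)]+[[z,x],\alpha(y)]=0$ for all $x,y,z\in\mathfrak{g}$. A compatible Hom-Lie algebra $(\mathfrak{g},[~,~]_1,[~,~]_2,\alpha)$ consists of two Hom-Lie algebras $(\mathfrak{g},[~,~]_1,\alpha)$, $(\mathfrak{g},[~,~]_2,\alpha)$ such that $(\mathfrak{g},\lambda[~,~]_1+\eta[~,~]_2,\alpha)$ is a Hom-Lie algebra for all $\lambda,\eta\in\mathbb{K}$. A morphism of compatible Hom-Lie algebras is a linear map intertwining the twisting maps and preserving both brackets. A Nijenhuis operator on $(\mathfrak{g},[~,~]_1,[~,~]_2,\alpha)$ is a linear map $N:\mathfrak{g}\to\mathfrak{g}$ with $\alpha\circ N=N\circ\alpha$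 and $[Nx,Ny]_i=N([Nx,y]_i+[x,Ny]_i-N[x,y]_i)$ for $i=1,2$ and all $x,y\in\mathfrak{g}$. A pair $(\omega_1,\omega_2)$ of skew-symmetric bilinear maps $\omega_i:\mathfrak{g}\times\mathfrak{g}\to\mathfrak{g}$ with $\alpha(\omega_i(x,y))=\omega_i(\alpha(x),\alpha(y))$ generates a linear deformation of $(\mathfrak{g},[~,~]_1,[~,~]_2,\alpha)$ if for all values of the parameter $t$ the quadruple $(\mathfrak{g},[~,~]_1+t\omega_1,[~,~]_2+t\omega_2,\alpha)$ is a compatible Hom-Lie algebra. Two linear deformations generated by $(\omega_1,\omega_2)$ and $(\omega_1',\omega_2')$ are equivalent if there is a linear map $M:\mathfrak{g}\to\mathfrak{g}$ with $\alpha\circ M=M\circ\alpha$ such that (for all $t$) $\mathrm{id}+tM:(\mathfrak{g},[~,~]_1+t\omega_1,[~,~]_2+t\omega_2,\alpha)\to(\mathfrak{g},[~,~]_1+t\omega_1',[~,~]_2+t\omega_2',\alpha)$ is a morphism of compatible Hom-Lie algebras. A linear deformation is trivial if it is equivalent to the undeformed one $([~,~]_1,[~,~]_2)$ (i.e. $\omega_1'=\omega_2'=0$). *)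

theory Defs
  imports Complex_Main
begin

text \<open>
  A vector space over a field of characteristic zero is a type \<open>'b\<close> with a scalar
  multiplication \<open>scale\<close> by a type \<open>'a\<close> of class \<^class>\<open>field_char_0\<close>; no finiteness of
  dimension is assumed.
\<close>

definition bilinear_map ::
  "('a::field_char_0 \<Rightarrow> 'b::ab_group_add \<Rightarrow> 'b) \<Rightarrow> ('b \<Rightarrow> 'b \<Rightarrow> 'b) \<Rightarrow> bool" where
  "bilinear_map scale f \<longleftrightarrow>
     (\<forall>x. Vector_Spaces.linear scale scale (\<lambda>y. f x y)) \<and>
     (\<forall>y. Vector_Spaces.linear scale scale (\<lambda>x. f x y))"

definition skew_symmetric :: "('b \<Rightarrow> 'b \<Rightarrow> 'b::ab_group_add) \<Rightarrow> bool" where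
  "skew_symmetric f \<longleftrightarrow> (\<forall>x y. f x y = - f y x)"

locale hom_lie_algebra = vector_space scale
  for scale :: "'a::field_char_0 \<Rightarrow> 'b::ab_group_add \<Rightarrow> 'b" +
  fixes bracket :: "'b \<Rightarrow> 'b \<Rightarrow> 'b"
    and \<alpha> :: "'b \<Rightarrow> 'b"
  assumes bilinear: "bilinear_map scale bracket"
    and skew: "skew_symmetric bracket"
    and twist_linear: "Vector_Spaces.linear scale scale \<alpha>"
    and multiplicative: "\<alpha> (bracket x y) = bracket (\<alpha> x) (\<alpha> y)"
    and hom_jacobi:
      "bracket (bracket x y) (\<alpha> z) + bracket (bracket y z) (\<alpha> x)
         + bracket (bracket z x) (\<alpha> y) = 0"

locale compatible_hom_lie_algebra =
  lie1: hom_lie_algebra scale br1 \<alpha> + lie2: hom_lie_algebra scale br2 \<alpha>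
  for scale :: "'a::field_char_0 \<Rightarrow> 'b::ab_group_add \<Rightarrow> 'b" and br1 br2 \<alpha> +
  assumes compatible:
    "hom_lie_algebra scale (\<lambda>x y. scale \<xi> (br1 x y) + scale \<eta> (br2 x y)) \<alpha>"

definition compatible_hom_lie_morphism ::
  "('a::field_char_0 \<Rightarrow> 'b::ab_group_add \<Rightarrow> 'b) \<Rightarrow> ('b \<Rightarrow> 'b \<Rightarrow> 'b) \<Rightarrow> ('b \<Rightarrow> 'b \<Rightarrow> 'b) \<Rightarrow> ('b \<Rightarrow> 'b) \<Rightarrow>
   ('a \<Rightarrow> 'c::ab_group_add \<Rightarrow> 'c) \<Rightarrow> ('c \<Rightarrow> 'c \<Rightarrow> 'c) \<Rightarrow> ('c \<Rightarrow> 'c \<Rightarrow> 'c) \<Rightarrow> ('c \<Rightarrow> 'c) \<Rightarrow>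
   ('b \<Rightarrow> 'c) \<Rightarrow> bool" where
  "compatible_hom_lie_morphism scale br1 br2 \<alpha> scale' br1' br2' \<alpha>' f \<longleftrightarrow>
     compatible_hom_lie_algebra scale br1 br2 \<alpha> \<and>
     compatible_hom_lie_algebra scale' br1' br2' \<alpha>' \<and>
     Vector_Spaces.linear scale scale' f \<and>
     (\<forall>x. f (\<alpha> x) = \<alpha>' (f x)) \<and>
     (\<forall>x y. f (br1 x y) = br1' (f x) (f y)) \<and>
     (\<forall>x y. f (br2 x y) = br2' (f x) (f y))"

definition nijenhuis_operator ::
  "('a::field_char_0 \<Rightarrow> 'b::ab_group_add \<Rightarrow> 'b) \<Rightarrow> ('b \<Rightarrow> 'b \<Rightarrow> 'b) \<Rightarrow> ('b \<Rightarrow> 'b \<Rightarrow> 'b) \<Rightarrow> ('b \<Rightarrow> 'b) \<Rightarrow>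
   ('b \<Rightarrow> 'b) \<Rightarrow> bool" where
  "nijenhuis_operator scale br1 br2 \<alpha> N \<longleftrightarrow>
     Vector_Spaces.linear scale scale N \<and>
     \<alpha> \<circ> N = N \<circ> \<alpha> \<and>
     (\<forall>x y. br1 (N x) (N y) = N (br1 (N x) y + br1 x (N y) - N (br1 x y))) \<and>
     (\<forall>x y. br2 (N x) (N y) = N (br2 (N x) y + br2 x (N y) - N (br2 x y)))"

definition deformed_bracket ::
  "('a::field_char_0 \<Rightarrow> 'b::ab_group_add \<Rightarrow> 'b) \<Rightarrow> ('b \<Rightarrow> 'b \<Rightarrow> 'b) \<Rightarrow> ('b \<Rightarrow> 'b \<Rightarrow> 'b) \<Rightarrow> 'a \<Rightarrow>
   'b \<Rightarrow> 'b \<Rightarrow> 'b" where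
  "deformed_bracket scale br \<omega> t x y = br x y + scale t (\<omega> x y)"

text \<open>The deformation parameter \<open>t\<close> ranges over the whole ground field.\<close>

definition generates_linear_deformation ::
  "('a::field_char_0 \<Rightarrow> 'b::ab_group_add \<Rightarrow> 'b) \<Rightarrow> ('b \<Rightarrow> 'b \<Rightarrow> 'b) \<Rightarrow> ('b \<Rightarrow> 'b \<Rightarrow> 'b) \<Rightarrow> ('b \<Rightarrow> 'b) \<Rightarrow>
   ('b \<Rightarrow> 'b \<Rightarrow> 'b) \<Rightarrow> ('b \<Rightarrow> 'b \<Rightarrow> 'b) \<Rightarrow> bool" where
  "generates_linear_deformation scale br1 br2 \<alpha> \<omega>1 \<omega>2 \<longleftrightarrow>
     bilinear_map scale \<omega>1 \<and> skew_symmetric \<omega>1 \<and> (\<forall>x y. \<alpha> (\<omega>1 x y) = \<omega>1 (\<alpha> x) (\<alpha> y)) \<and>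
     bilinear_map scale \<omega>2 \<and> skew_symmetric \<omega>2 \<and> (\<forall>x y. \<alpha> (\<omega>2 x y) = \<omega>2 (\<alpha> x) (\<alpha> y)) \<and>
     (\<forall>t. compatible_hom_lie_algebra scale
            (deformed_bracket scale br1 \<omega>1 t) (deformed_bracket scale br2 \<omega>2 t) \<alpha>)"

text \<open>A single \<open>M\<close>, independent of \<open>t\<close>, has to work for all values of the parameter.\<close>

definition equivalent_linear_deformations ::
  "('a::field_char_0 \<Rightarrow> 'b::ab_group_add \<Rightarrow> 'b) \<Rightarrow> ('b \<Rightarrow> 'b \<Rightarrow> 'b) \<Rightarrow> ('b \<Rightarrow> 'b \<Rightarrow> 'b) \<Rightarrow> ('b \<Rightarrow> 'b) \<Rightarrow>
   ('b \<Rightarrow> 'b \<Rightarrow> 'b) \<Rightarrow> ('b \<Rightarrow> 'b \<Rightarrow> 'b) \<Rightarrow> ('b \<Rightarrow> 'b \<Rightarrow> 'b) \<Rightarrow> ('b \<Rightarrow> 'b \<Rightarrow> 'b) \<Rightarrow> bool" where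
  "equivalent_linear_deformations scale br1 br2 \<alpha> \<omega>1 \<omega>2 \<omega>1' \<omega>2' \<longleftrightarrow>
     generates_linear_deformation scale br1 br2 \<alpha> \<omega>1 \<omega>2 \<and>
     generates_linear_deformation scale br1 br2 \<alpha> \<omega>1' \<omega>2' \<and>
     (\<exists>M. Vector_Spaces.linear scale scale M \<and> \<alpha> \<circ> M = M \<circ> \<alpha> \<and>
       (\<forall>t. compatible_hom_lie_morphism
              scale (deformed_bracket scale br1 \<omega>1 t) (deformed_bracket scale br2 \<omega>2 t) \<alpha>
              scale (deformed_bracket scale br1 \<omega>1' t) (deformed_bracket scale br2 \<omega>2' t) \<alpha>
              (\<lambda>x. x + scale t (M x))))"

definition generates_trivial_linear_deformation ::
  "('a::field_char_0 \<Rightarrow> 'b::ab_group_add \<Rightarrow> 'b) \<Rightarrow> ('b \<Rightarrow> 'b \<Rightarrow> 'b) \<Rightarrow> ('b \<Rightarrow> 'b \<Rightarrow> 'b) \<Rightarrow> ('b \<Rightarrow> 'b) \<Rightarrow>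
   ('b \<Rightarrow> 'b \<Rightarrow> 'b) \<Rightarrow> ('b \<Rightarrow> 'b \<Rightarrow> 'b) \<Rightarrow> bool" where
  "generates_trivial_linear_deformation scale br1 br2 \<alpha> \<omega>1 \<omega>2 \<longleftrightarrow>
     generates_linear_deformation scale br1 br2 \<alpha> \<omega>1 \<omega>2 \<and>
     equivalent_linear_deformations scale br1 br2 \<alpha> \<omega>1 \<omega>2 (\<lambda>x y. 0) (\<lambda>x y. 0)"

end

theory Submission
  imports Defs
begin

text \<open>
  The Nijenhuis identity for a bracket and the bracket \<open>\<omega>\<close> that \<open>N\<close> induces from it are both
  linear in the bracket. Hence a Nijenhuis operator of a compatible pair is one for every combination
  \<open>\<xi> [,]\<^sub>1 + \<eta> [,]\<^sub>2\<close>, and deforming the combination gives the combination of the deformed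
  brackets. So compatibility of the deformed pair reduces to a claim about a single Hom-Lie
  algebra: if \<open>N\<close> is Nijenhuis, then \<open>[,] + t \<omega>\<close> is again a Hom-Lie bracket for every \<open>t\<close>
  (\<open>hom_lie_deformed_bracket\<close>).

  Its Hom-Jacobi identity is checked coefficientwise in \<open>t\<close>. The first-order coefficient
  (\<open>jacobi_mixed\<close>) vanishes because \<open>\<omega>\<close> is a coboundary: it is the infinitesimal change of the
  bracket under \<open>id + t N\<close>, and \<open>N\<close> commutes with \<open>\<alpha>\<close>. The second-order one
  (\<open>jacobi_nijenhuis_bracket\<close>) is where the Nijenhuis identity enters.

  Finally, \<open>id + t N\<close> intertwines \<open>[,] + t \<omega>\<close> with \<open>[,]\<close>: comparing
  \<open>(id + t N)([x,y] + t \<omega>(x,y))\<close> with \<open>[x + t N x, y + t N y]\<close>, the coefficients of \<open>t\<close> agree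
  by the definition of \<open>\<omega>\<close> and those of \<open>t\<^sup>2\<close> by \<open>N \<omega>(x,y) = [N x, N y]\<close>. Thus \<open>M = N\<close>
  witnesses triviality. The Jacobi identity cannot be pulled back along this morphism, because
  \<open>id + t N\<close> need not be injective.
\<close>

section \<open>Deforming a single Hom-Lie bracket\<close>

definition nijenhuis_bracket :: "('b \<Rightarrow> 'b \<Rightarrow> 'b) \<Rightarrow> ('b \<Rightarrow> 'b) \<Rightarrow> 'b \<Rightarrow> 'b \<Rightarrow> 'b::ab_group_add" where
  "nijenhuis_bracket br N x y = br (N x) y + br x (N y) - N (br x y)"

lemma bilinear_map_iff:
  "bilinear_map scale f \<longleftrightarrow> vector_space scale \<and>
     (\<forall>x y z. f (x + y) z = f x z + f y z) \<and> (\<forall>x y z. f x (y + z) = f x y + f x z) \<and>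
     (\<forall>c x y. f (scale c x) y = scale c (f x y)) \<and> (\<forall>c x y. f x (scale c y) = scale c (f x y))"
  unfolding bilinear_map_def Vector_Spaces.linear_iff by auto

locale nijenhuis_hom_lie = hom_lie_algebra scale bracket \<alpha>
  for scale :: "'a::field_char_0 \<Rightarrow> 'b::ab_group_add \<Rightarrow> 'b" and bracket \<alpha> +
  fixes N :: "'b \<Rightarrow> 'b"
  assumes N_linear: "Vector_Spaces.linear scale scale N"
    and N_twist: "\<alpha> (N x) = N (\<alpha> x)"
    and nijenhuis: "bracket (N x) (N y) = N (nijenhuis_bracket bracket N x y)"
begin

abbreviation \<omega> where "\<omega> \<equiv> nijenhuis_bracket bracket N"

lemma bracket_simps:
  "bracket (x + y) z = bracket x z + bracket y z"
  "bracket x (y + z) = bracket x y + bracket x z"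
  "bracket (scale c x) y = scale c (bracket x y)"
  "bracket x (scale c y) = scale c (bracket x y)"
  "bracket (x - y) z = bracket x z - bracket y z"
  "bracket x (y - z) = bracket x y - bracket x z"
proof -
  have b: "bracket (x + y) z = bracket x z + bracket y z"
    "bracket x (y + z) = bracket x y + bracket x z" for x y z
    using bilinear by (auto simp: bilinear_map_iff)
  show "bracket (x + y) z = bracket x z + bracket y z"
    "bracket x (y + z) = bracket x y + bracket x z" by (fact b)+
  show "bracket (scale c x) y = scale c (bracket x y)"
    "bracket x (scale c y) = scale c (bracket x y)"
    using bilinear by (auto simp: bilinear_map_iff)
  show "bracket (x - y) z = bracket x z - bracket y z"
    using b(1)[of "x - y" y z] by (simp add: algebra_simps)
  show "bracket x (y - z) = bracket x y - bracket x z"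
    using b(2)[of x "y - z" z] by (simp add: algebra_simps)
qed

lemma N_simps:
  "N (x + y) = N x + N y" "N (scale c x) = scale c (N x)"
  "N (x - y) = N x - N y" "N (- x) = - N x" "N 0 = 0"
proof -
  interpret N: Vector_Spaces.linear scale scale N by (rule N_linear)
  show "N (x + y) = N x + N y" "N (scale c x) = scale c (N x)"
    "N (x - y) = N x - N y" "N (- x) = - N x" "N 0 = 0"
    by (simp_all add: N.add N.scale N.diff N.neg)
qed

lemma twist_simps:
  "\<alpha> (x + y) = \<alpha> x + \<alpha> y" "\<alpha> (scale c x) = scale c (\<alpha> x)" "\<alpha> (x - y) = \<alpha> x - \<alpha> y"
proof -
  interpret \<alpha>: Vector_Spaces.linear scale scale \<alpha> by (rule twist_linear)
  show "\<alpha> (x + y) = \<alpha> x + \<alpha> y" "\<alpha> (scale c x) = scale c (\<alpha> x)" "\<alpha> (x - y) = \<alpha> x - \<alpha> y"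
    by (simp_all add: \<alpha>.add \<alpha>.scale \<alpha>.diff)
qed

lemma bracket_skew: "bracket x y = - bracket y x"
  using skew unfolding skew_symmetric_def by blast

lemma bilinear_nijenhuis_bracket: "bilinear_map scale \<omega>"
  unfolding bilinear_map_iff nijenhuis_bracket_def
  by (simp add: vector_space_axioms bracket_simps N_simps scale_right_distrib
      scale_right_diff_distrib)

lemma skew_nijenhuis_bracket: "skew_symmetric \<omega>"
  unfolding skew_symmetric_def
proof (intro allI)
  fix x y
  have "\<omega> x y = - bracket y (N x) + - bracket (N y) x - N (- bracket y x)"
    unfolding nijenhuis_bracket_def
    by (simp only: bracket_skew[of "N x" y] bracket_skew[of x "N y"] bracket_skew[of x y])
  also have "\<dots> = - \<omega> y x"
    by (simp add: nijenhuis_bracket_def N_simps)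
  finally show "\<omega> x y = - \<omega> y x" .
qed

lemma twist_nijenhuis_bracket: "\<alpha> (\<omega> x y) = \<omega> (\<alpha> x) (\<alpha> y)"
  by (simp add: nijenhuis_bracket_def twist_simps multiplicative N_twist)

definition J where
  "J x y z = bracket (bracket x y) (\<alpha> z) + bracket (bracket y z) (\<alpha> x)
     + bracket (bracket z x) (\<alpha> y)"

lemma J_zero: "J x y z = 0"
  unfolding J_def by (rule hom_jacobi)

text \<open>
  After cancelling \<open>[N [x,y], \<alpha> z]\<close>, which occurs with both signs, the sum is
  \<open>J(N x, y, z) + J(x, N y, z) + J(x, y, N z) - N J(x, y, z)\<close>.
\<close>

lemma jacobi_mixed:
  "\<omega> (bracket x y) (\<alpha> z) + \<omega> (bracket y z) (\<alpha> x) + \<omega> (bracket z x) (\<alpha> y)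
     + (bracket (\<omega> x y) (\<alpha> z) + bracket (\<omega> y z) (\<alpha> x) + bracket (\<omega> z x) (\<alpha> y)) = 0"
    (is "?L = 0")
proof -
  have expand: "\<omega> (bracket u v) (\<alpha> w) = bracket (bracket u v) (\<alpha> (N w))
      + bracket (bracket (N u) v) (\<alpha> w) + bracket (bracket u (N v)) (\<alpha> w)
      - N (bracket (bracket u v) (\<alpha> w)) - bracket (\<omega> u v) (\<alpha> w)" for u v w
    by (simp add: nijenhuis_bracket_def bracket_simps N_twist)
  have "?L = J (N x) y z + J x (N y) z + J x y (N z) - N (J x y z)"
    unfolding expand by (simp add: J_def N_simps)
  then show ?thesis by (simp add: J_zero N_simps)
qed

text \<open>
  The Nijenhuis identity rewrites \<open>[N \<omega>(x,y), \<alpha> z]\<close> as \<open>[[N x, N y], \<alpha> z]\<close>, which completes the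
  cyclic sums \<open>J\<close> with \<open>N\<close> applied to two of the three arguments. What remains is the image under
  \<open>-N\<close> of the mixed sum, because \<open>[N [x,y], N \<alpha> z] = N \<omega>([x,y], \<alpha> z)\<close>.
\<close>

lemma jacobi_nijenhuis_bracket:
  "\<omega> (\<omega> x y) (\<alpha> z) + \<omega> (\<omega> y z) (\<alpha> x) + \<omega> (\<omega> z x) (\<alpha> y) = 0"
    (is "?L = 0")
proof -
  let ?mixed = "\<omega> (bracket x y) (\<alpha> z) + \<omega> (bracket y z) (\<alpha> x) + \<omega> (bracket z x) (\<alpha> y)
     + (bracket (\<omega> x y) (\<alpha> z) + bracket (\<omega> y z) (\<alpha> x) + bracket (\<omega> z x) (\<alpha> y))"
  have expand: "\<omega> (\<omega> u v) (\<alpha> w) = bracket (bracket (N u) (N v)) (\<alpha> w)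
      + bracket (bracket (N u) v) (\<alpha> (N w)) + bracket (bracket u (N v)) (\<alpha> (N w))
      - N (\<omega> (bracket u v) (\<alpha> w)) - N (bracket (\<omega> u v) (\<alpha> w))" for u v w
  proof -
    have "\<omega> (\<omega> u v) (\<alpha> w) = bracket (N (\<omega> u v)) (\<alpha> w) + bracket (\<omega> u v) (N (\<alpha> w))
        - N (bracket (\<omega> u v) (\<alpha> w))"
      by (rule nijenhuis_bracket_def)
    also have "bracket (N (\<omega> u v)) (\<alpha> w) = bracket (bracket (N u) (N v)) (\<alpha> w)"
      by (simp only: nijenhuis)
    also have "bracket (\<omega> u v) (N (\<alpha> w)) = bracket (bracket (N u) v) (\<alpha> (N w))
        + bracket (bracket u (N v)) (\<alpha> (N w)) - bracket (N (bracket u v)) (N (\<alpha> w))"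
      by (simp add: nijenhuis_bracket_def bracket_simps N_twist)
    also have "bracket (N (bracket u v)) (N (\<alpha> w)) = N (\<omega> (bracket u v) (\<alpha> w))"
      by (rule nijenhuis)
    finally show ?thesis by (simp add: algebra_simps)
  qed
  have "?L = J (N x) (N y) z + J (N x) y (N z) + J x (N y) (N z) - N ?mixed"
    unfolding expand by (simp add: J_def N_simps algebra_simps)
  then show ?thesis unfolding jacobi_mixed by (simp add: J_zero N_simps)
qed

lemma hom_lie_deformed_bracket: "hom_lie_algebra scale (deformed_bracket scale bracket \<omega> t) \<alpha>"
proof (intro hom_lie_algebra.intro hom_lie_algebra_axioms.intro)
  show "vector_space scale" by (rule vector_space_axioms)
  show "Vector_Spaces.linear scale scale \<alpha>" by (rule twist_linear)
  let ?b = "deformed_bracket scale bracket \<omega> t"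
  have \<omega>_simps: "\<omega> (x + y) z = \<omega> x z + \<omega> y z" "\<omega> x (y + z) = \<omega> x y + \<omega> x z"
    "\<omega> (scale c x) y = scale c (\<omega> x y)" "\<omega> x (scale c y) = scale c (\<omega> x y)" for x y z c
    using bilinear_nijenhuis_bracket by (auto simp: bilinear_map_iff)
  show "bilinear_map scale ?b"
    unfolding bilinear_map_iff deformed_bracket_def
    by (simp add: vector_space_axioms bracket_simps \<omega>_simps scale_right_distrib mult.commute)
  show "skew_symmetric ?b"
    unfolding skew_symmetric_def deformed_bracket_def
  proof (intro allI)
    fix x y
    have "\<omega> x y = - \<omega> y x"
      using skew_nijenhuis_bracket unfolding skew_symmetric_def by blast
    then have "bracket x y + scale t (\<omega> x y) = - bracket y x + scale t (- \<omega> y x)"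
      by (simp only: bracket_skew[of x y])
    then show "bracket x y + scale t (\<omega> x y) = - (bracket y x + scale t (\<omega> y x))"
      by simp
  qed
  fix x y z
  show "\<alpha> (?b x y) = ?b (\<alpha> x) (\<alpha> y)"
    by (simp add: deformed_bracket_def twist_simps multiplicative twist_nijenhuis_bracket)
  let ?mixed = "\<omega> (bracket x y) (\<alpha> z) + \<omega> (bracket y z) (\<alpha> x) + \<omega> (bracket z x) (\<alpha> y)
     + (bracket (\<omega> x y) (\<alpha> z) + bracket (\<omega> y z) (\<alpha> x) + bracket (\<omega> z x) (\<alpha> y))"
  have "?b (?b x y) (\<alpha> z) + ?b (?b y z) (\<alpha> x) + ?b (?b z x) (\<alpha> y)
      = (bracket (bracket x y) (\<alpha> z) + bracket (bracket y z) (\<alpha> x) + bracket (bracket z x) (\<alpha> y))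
        + scale t ?mixed
        + scale (t * t) (\<omega> (\<omega> x y) (\<alpha> z) + \<omega> (\<omega> y z) (\<alpha> x) + \<omega> (\<omega> z x) (\<alpha> y))"
    by (simp add: deformed_bracket_def bracket_simps \<omega>_simps scale_right_distrib add_ac)
  also have "\<dots> = 0"
    by (simp only: hom_jacobi jacobi_mixed jacobi_nijenhuis_bracket scale_zero_right add_0)
  finally show "?b (?b x y) (\<alpha> z) + ?b (?b y z) (\<alpha> x) + ?b (?b z x) (\<alpha> y) = 0" .
qed

lemma intertwines_deformed_bracket:
  "deformed_bracket scale bracket \<omega> t x y + scale t (N (deformed_bracket scale bracket \<omega> t x y))
     = bracket (x + scale t (N x)) (y + scale t (N y))"
proof -
  have "bracket (N x) y + bracket x (N y) = \<omega> x y + N (bracket x y)"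
    by (simp add: nijenhuis_bracket_def)
  then have "scale t (bracket (N x) y) + scale t (bracket x (N y))
      = scale t (\<omega> x y) + scale t (N (bracket x y))"
    by (simp flip: scale_right_distrib)
  then show ?thesis
    by (simp add: deformed_bracket_def N_simps bracket_simps nijenhuis scale_right_distrib add_ac)
qed

end

section \<open>Deforming a compatible pair\<close>

lemma deformed_bracket_zero:
  assumes "vector_space scale"
  shows "deformed_bracket scale br (\<lambda>x y. 0) t = br"
proof -
  interpret vector_space scale by fact
  show ?thesis by (simp add: deformed_bracket_def fun_eq_iff)
qed

lemma generates_linear_deformation_zero:
  assumes "compatible_hom_lie_algebra scale br1 br2 \<alpha>"
  shows "generates_linear_deformation scale br1 br2 \<alpha> (\<lambda>x y. 0) (\<lambda>x y. 0)"
proof -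
  interpret compatible_hom_lie_algebra scale br1 br2 \<alpha> by fact
  interpret \<alpha>: Vector_Spaces.linear scale scale \<alpha> by (rule lie1.twist_linear)
  show ?thesis
    using assms lie1.vector_space_axioms \<alpha>.zero
    by (simp add: generates_linear_deformation_def bilinear_map_iff skew_symmetric_def
        deformed_bracket_zero)
qed

locale nijenhuis_compatible_hom_lie = compatible_hom_lie_algebra scale br1 br2 \<alpha>
  for scale :: "'a::field_char_0 \<Rightarrow> 'b::ab_group_add \<Rightarrow> 'b" and br1 br2 \<alpha> +
  fixes N :: "'b \<Rightarrow> 'b"
  assumes nijenhuis_N: "nijenhuis_operator scale br1 br2 \<alpha> N"
begin

lemma N_commutes: "\<alpha> (N x) = N (\<alpha> x)"
  using nijenhuis_N by (simp add: nijenhuis_operator_def fun_eq_iff)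

sublocale n1: nijenhuis_hom_lie scale br1 \<alpha> N
  by (intro_locales, rule nijenhuis_hom_lie_axioms.intro)
    (use nijenhuis_N N_commutes in \<open>simp_all add: nijenhuis_operator_def nijenhuis_bracket_def\<close>)

sublocale n2: nijenhuis_hom_lie scale br2 \<alpha> N
  by (intro_locales, rule nijenhuis_hom_lie_axioms.intro)
    (use nijenhuis_N N_commutes in \<open>simp_all add: nijenhuis_operator_def nijenhuis_bracket_def\<close>)

abbreviation "combined \<xi> \<eta> \<equiv> (\<lambda>x y. scale \<xi> (br1 x y) + scale \<eta> (br2 x y))"

lemma nijenhuis_bracket_combined:
  "nijenhuis_bracket (combined \<xi> \<eta>) N x y
     = scale \<xi> (nijenhuis_bracket br1 N x y) + scale \<eta> (nijenhuis_bracket br2 N x y)"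
  by (simp add: nijenhuis_bracket_def n1.N_simps lie1.scale_right_distrib
      lie1.scale_right_diff_distrib algebra_simps)

lemma nijenhuis_combined: "nijenhuis_hom_lie scale (combined \<xi> \<eta>) \<alpha> N"
proof -
  interpret c: hom_lie_algebra scale "combined \<xi> \<eta>" \<alpha> by (rule compatible)
  show ?thesis
    by (intro_locales, rule nijenhuis_hom_lie_axioms.intro)
      (simp_all add: n1.N_linear N_commutes nijenhuis_bracket_combined n1.nijenhuis n2.nijenhuis
        n1.N_simps)
qed

lemma compatible_deformed_brackets:
  "compatible_hom_lie_algebra scale
     (deformed_bracket scale br1 (nijenhuis_bracket br1 N) t)
     (deformed_bracket scale br2 (nijenhuis_bracket br2 N) t) \<alpha>"
proof (rule compatible_hom_lie_algebra.intro)
  show "compatible_hom_lie_algebra_axioms scale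
     (deformed_bracket scale br1 (nijenhuis_bracket br1 N) t)
     (deformed_bracket scale br2 (nijenhuis_bracket br2 N) t) \<alpha>"
  proof (rule compatible_hom_lie_algebra_axioms.intro)
    fix \<xi> \<eta>
    interpret c: nijenhuis_hom_lie scale "combined \<xi> \<eta>" \<alpha> N by (rule nijenhuis_combined)
    \<comment> \<open>A combination of the deformed brackets is a deformation of the combination, to which the
      result for a single bracket applies.\<close>
    have "(\<lambda>x y. scale \<xi> (deformed_bracket scale br1 (nijenhuis_bracket br1 N) t x y)
          + scale \<eta> (deformed_bracket scale br2 (nijenhuis_bracket br2 N) t x y))
        = deformed_bracket scale (combined \<xi> \<eta>) (nijenhuis_bracket (combined \<xi> \<eta>) N) t"
      by (intro ext, simp only: deformed_bracket_def nijenhuis_bracket_combined)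
        (simp add: lie1.scale_right_distrib mult.commute add_ac)
    then show "hom_lie_algebra scale
        (\<lambda>x y. scale \<xi> (deformed_bracket scale br1 (nijenhuis_bracket br1 N) t x y)
          + scale \<eta> (deformed_bracket scale br2 (nijenhuis_bracket br2 N) t x y)) \<alpha>"
      using c.hom_lie_deformed_bracket by simp
  qed
qed (rule n1.hom_lie_deformed_bracket n2.hom_lie_deformed_bracket)+

lemma generates_linear_deformation_nijenhuis:
  "generates_linear_deformation scale br1 br2 \<alpha> (nijenhuis_bracket br1 N) (nijenhuis_bracket br2 N)"
  by (simp add: generates_linear_deformation_def compatible_deformed_brackets
      n1.bilinear_nijenhuis_bracket n1.skew_nijenhuis_bracket n1.twist_nijenhuis_bracket
      n2.bilinear_nijenhuis_bracket n2.skew_nijenhuis_bracket n2.twist_nijenhuis_bracket)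

lemma morphism_to_undeformed:
  "compatible_hom_lie_morphism
     scale (deformed_bracket scale br1 (nijenhuis_bracket br1 N) t)
       (deformed_bracket scale br2 (nijenhuis_bracket br2 N) t) \<alpha>
     scale br1 br2 \<alpha> (\<lambda>x. x + scale t (N x))"
proof -
  have "Vector_Spaces.linear scale scale (\<lambda>x. x + scale t (N x))"
    using lie1.vector_space_axioms
    by (simp add: Vector_Spaces.linear_iff n1.N_simps lie1.scale_right_distrib mult.commute add_ac)
  then show ?thesis
    unfolding compatible_hom_lie_morphism_def
    using compatible_deformed_brackets compatible_hom_lie_algebra_axioms
    by (simp add: n1.intertwines_deformed_bracket n2.intertwines_deformed_bracket
        n1.twist_simps N_commutes)
qed

lemma trivial_deformation:
  "generates_trivial_linear_deformation scale br1 br2 \<alpha>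
     (nijenhuis_bracket br1 N) (nijenhuis_bracket br2 N)"
  unfolding generates_trivial_linear_deformation_def equivalent_linear_deformations_def
    deformed_bracket_zero[OF lie1.vector_space_axioms]
  using generates_linear_deformation_nijenhuis morphism_to_undeformed
    generates_linear_deformation_zero[OF compatible_hom_lie_algebra_axioms]
    n1.N_linear N_commutes
  by (auto intro!: exI[of _ N])

end

theorem proposition5p6:
  fixes scale :: "'a::field_char_0 \<Rightarrow> 'b::ab_group_add \<Rightarrow> 'b"
    and br1 br2 :: "'b \<Rightarrow> 'b \<Rightarrow> 'b"
    and \<alpha> N :: "'b \<Rightarrow> 'b"
  assumes "compatible_hom_lie_algebra scale br1 br2 \<alpha>"
    and "nijenhuis_operator scale br1 br2 \<alpha> N"
  shows "generates_trivial_linear_deformation scale br1 br2 \<alpha>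
           (\<lambda>x y. br1 (N x) y + br1 x (N y) - N (br1 x y))
           (\<lambda>x y. br2 (N x) y + br2 x (N y) - N (br2 x y))"
proof -
  interpret compatible_hom_lie_algebra scale br1 br2 \<alpha> by fact
  interpret nijenhuis_compatible_hom_lie scale br1 br2 \<alpha> N
    by unfold_locales fact
  show ?thesis
    using trivial_deformation unfolding nijenhuis_bracket_def .
qed

end
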